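(* Define the relation $\succ^{\mathit{sub}}$ on $\mathcal{EL}$ GCIs by: $C\sqsubseteq D\ \succ^{\mathit{sub}}\ C'\sqsubseteq D'$ iff $C'=C$, $D\sqsubseteq^\emptyset D'$ and $\{C\sqsubseteq D'\}\not\models C\sqsubseteq D$. Then $\succ^{\mathit{sub}}$ is a well-founded, complete, and one-step generated weakening relation, but it is not polynomial.
   Context: $\mathcal{EL}$ concepts: $C::=A\mid\top\mid C\sqcap C\mid\exists r.C$ ($A$ concept name, $r$ role name), with size = number of occurrences of $\top$, concept names and role names. A GCI $C\sqsubseteq D$ is satisfied by an interpretation $\mathcal{I}$ iff $C^\mathcal{I}\subseteq D^\mathcal{I}$, where $\top^\mathcal{I}=\Delta^\mathcal{I}$, $(C\sqcap D)^\mathcal{I}=C^\mathcal{I}\cap D^\mathcal{I}$, $(\exists r.C)^\mathcal{I}=\{d\mid\exists e\in C^\mathcal{I},(d,e)\in r^\mathcal{I}\}$. $\mathfrak{O}\models\alpha$ iff every model of $\mathfrak{O}$ satisfies $\alpha$; $\mathit{Con}(\mathfrak{O})=\{\alpha\mid\mathfrak{O}\models\alpha\}$; a tautology is $\alpha$ with $\emptyset\models\alpha$; $C\sqsubseteq^\emptyset D$ means $C\sqsubseteq D$ is a tautology. A pre-order (irreflexive, transitive) $\succ$ on GCIs is a weakening relation if $\beta\succ\gamma$ implies $\mathit{Con}(\{\gamma\})\subsetneq\mathit{Con}(\{\beta\})$; well-founded if there is no infinite chain $\beta_1\succ\beta_2\succ\cdots$; complete if every non-tautology $\beta$ has a tautology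 $\gamma$ with $\beta\succ\gamma$; one-step generated if the transitive closure of $\succ_1=\{(\beta,\gamma)\in\succ\mid$ no $\delta$ with $\beta\succ\delta\succ\gamma\}$ equals $\succ$; polynomial if there is a polynomial $p$ such that every $\succ$-chain issuing from any $\beta$ has length at most $p(\text{size of }\beta)$. *)

theory Defs
  imports Main "HOL-Computational_Algebra.Polynomial"
begin

datatype ('c, 'r) concept =
    Top
  | Name 'c
  | Conj "('c, 'r) concept" "('c, 'r) concept"
  | Ex 'r "('c, 'r) concept"

datatype ('c, 'r) gci = GCI (lhs: "('c, 'r) concept") (rhs: "('c, 'r) concept")

primrec concept_size :: "('c, 'r) concept \<Rightarrow> nat" where
  "concept_size Top = 1"
| "concept_size (Name A) = 1"
| "concept_size (Conj C D) = concept_size C + concept_size D"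
| "concept_size (Ex r C) = 1 + concept_size C"

definition gci_size :: "('c, 'r) gci \<Rightarrow> nat" where
  "gci_size \<beta> = concept_size (lhs \<beta>) + concept_size (rhs \<beta>)"

record ('c, 'r, 'd) interp =
  dom :: "'d set"
  name_int :: "'c \<Rightarrow> 'd set"
  role_int :: "'r \<Rightarrow> ('d \<times> 'd) set"

definition is_interp :: "('c, 'r, 'd) interp \<Rightarrow> bool" where
  "is_interp I \<longleftrightarrow> dom I \<noteq> {} \<and> (\<forall>A. name_int I A \<subseteq> dom I) \<and>
     (\<forall>r. role_int I r \<subseteq> dom I \<times> dom I)"

primrec ext :: "('c, 'r, 'd) interp \<Rightarrow> ('c, 'r) concept \<Rightarrow> 'd set" where
  "ext I Top = dom I"
| "ext I (Name A) = name_int I A"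
| "ext I (Conj C D) = ext I C \<inter> ext I D"
| "ext I (Ex r C) = {d. \<exists>e \<in> ext I C. (d, e) \<in> role_int I r}"

definition satisfies :: "('c, 'r, 'd) interp \<Rightarrow> ('c, 'r) gci \<Rightarrow> bool" where
  "satisfies I \<beta> \<longleftrightarrow> ext I (lhs \<beta>) \<subseteq> ext I (rhs \<beta>)"

definition is_model :: "('c, 'r, 'd) interp \<Rightarrow> ('c, 'r) gci set \<Rightarrow> bool" where
  "is_model I ont \<longleftrightarrow> is_interp I \<and> (\<forall>\<beta> \<in> ont. satisfies I \<beta>)"

text \<open>A definition cannot quantify over domains of arbitrary type, so entailment ranges over
  the interpretations whose domain is a nonempty set of concepts. This is no restriction: by
  \<open>entails_iff_any_domain\<close> below, the same relation results from admitting, in addition,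
  domains from any other type.\<close>

definition entails :: "('c, 'r) gci set \<Rightarrow> ('c, 'r) gci \<Rightarrow> bool" where
  "entails ont \<alpha> \<longleftrightarrow>
     (\<forall>I :: ('c, 'r, ('c, 'r) concept) interp. is_model I ont \<longrightarrow> satisfies I \<alpha>)"

text \<open>Every interpretation satisfies the same GCIs as its canonical interpretation, whose
  elements are the concepts.\<close>

definition canonical :: "('c, 'r, 'd) interp \<Rightarrow> ('c, 'r, ('c, 'r) concept) interp" where
  "canonical I = \<lparr>dom = UNIV,
     name_int = (\<lambda>A. {C. ext I C \<subseteq> ext I (Name A)}),
     role_int = (\<lambda>r. {(C, D). ext I C \<subseteq> ext I (Ex r D)})\<rparr>"

lemma ext_subset_dom: "is_interp I \<Longrightarrow> ext I C \<subseteq> dom I"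
  by (induction C) (auto simp: is_interp_def)

lemma ext_canonical:
  assumes "is_interp I"
  shows "ext (canonical I) E = {C. ext I C \<subseteq> ext I E}"
proof (induction E)
  case Top
  then show ?case using ext_subset_dom[OF assms] by (auto simp: canonical_def)
next
  case (Ex r E)
  then show ?case by (fastforce simp: canonical_def)
qed (auto simp: canonical_def)

lemma satisfies_canonical: "is_interp I \<Longrightarrow> satisfies (canonical I) \<beta> \<longleftrightarrow> satisfies I \<beta>"
  by (auto simp: satisfies_def ext_canonical)

lemma is_interp_canonical: "is_interp (canonical I)"
  by (simp add: is_interp_def canonical_def)

lemma entails_iff_any_domain:
  "entails ont \<alpha> \<longleftrightarrow>
     (\<forall>I :: ('c, 'r, ('c, 'r) concept) interp. is_model I ont \<longrightarrow> satisfies I \<alpha>) \<and>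
     (\<forall>I :: ('c, 'r, 'd) interp. is_model I ont \<longrightarrow> satisfies I \<alpha>)"
  unfolding entails_def is_model_def
  by (metis satisfies_canonical is_interp_canonical)

definition Con :: "('c, 'r) gci set \<Rightarrow> ('c, 'r) gci set" where
  "Con ont = {\<alpha>. entails ont \<alpha>}"

definition tautology :: "('c, 'r) gci \<Rightarrow> bool" where
  "tautology \<alpha> \<longleftrightarrow> entails {} \<alpha>"

text \<open>In the following, \<open>(\<beta>, \<gamma>) \<in> R\<close> means that \<open>\<gamma>\<close> is weaker than \<open>\<beta>\<close>.\<close>

definition weakening_relation :: "('c, 'r) gci rel \<Rightarrow> bool" where
  "weakening_relation R \<longleftrightarrow> irrefl R \<and> trans R \<and> (\<forall>(\<beta>, \<gamma>) \<in> R. Con {\<gamma>} \<subset> Con {\<beta>})"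

definition well_founded_rel :: "('c, 'r) gci rel \<Rightarrow> bool" where
  "well_founded_rel R \<longleftrightarrow> \<not> (\<exists>f :: nat \<Rightarrow> ('c, 'r) gci. \<forall>i. (f i, f (Suc i)) \<in> R)"

definition complete_rel :: "('c, 'r) gci rel \<Rightarrow> bool" where
  "complete_rel R \<longleftrightarrow> (\<forall>\<beta>. \<not> tautology \<beta> \<longrightarrow> (\<exists>\<gamma>. tautology \<gamma> \<and> (\<beta>, \<gamma>) \<in> R))"

definition one_step :: "('c, 'r) gci rel \<Rightarrow> ('c, 'r) gci rel" where
  "one_step R = {(\<beta>, \<gamma>) \<in> R. \<not> (\<exists>\<delta>. (\<beta>, \<delta>) \<in> R \<and> (\<delta>, \<gamma>) \<in> R)}"

definition one_step_generated :: "('c, 'r) gci rel \<Rightarrow> bool" where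
  "one_step_generated R \<longleftrightarrow> (one_step R)\<^sup>+ = R"

text \<open>A chain issuing from \<open>\<beta>\<close> and having \<open>n\<close> steps exists iff \<open>(\<beta>, \<gamma>) \<in> R ^^ n\<close> for some \<open>\<gamma>\<close>.
  Counting elements instead of steps, or restricting the coefficients of \<open>p\<close> to natural
  numbers, gives the same notion.\<close>

definition polynomial_rel :: "('c, 'r) gci rel \<Rightarrow> bool" where
  "polynomial_rel R \<longleftrightarrow>
     (\<exists>p :: real poly. \<forall>\<beta> \<gamma> n. (\<beta>, \<gamma>) \<in> R ^^ n \<longrightarrow> real n \<le> poly p (real (gci_size \<beta>)))"

definition succ_sub :: "('c, 'r) gci rel" where
  "succ_sub = {(GCI C D, GCI C' D') | C D C' D'.
     C' = C \<and> tautology (GCI D D') \<and> \<not> entails {GCI C D'} (GCI C D)}"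

end

theory Submission
  imports Defs "HOL-Real_Asymp.Real_Asymp"
begin

text \<open>A concept \<open>D\<close> has only finitely many subsumers up to equivalence, and their number strictly
  decreases along \<open>succ_sub\<close>; well-foundedness and one-step generation follow. For the lower
  bound, let \<open>P\<^sub>i = \<exists>r\<^sup>i\<^sup>+\<^sup>1.A\<close>. The concept \<open>\<exists>r.(P\<^sub>0 \<sqinter> \<dots> \<sqinter> P\<^sub>2\<^sub>n\<^sub>-\<^sub>1)\<close> is subsumed by the \<open>2\<^sup>n\<close> pairwise
  incomparable concepts \<open>\<exists>r.X\<close> where \<open>X\<close> selects one of \<open>P\<^sub>2\<^sub>i\<close>, \<open>P\<^sub>2\<^sub>i\<^sub>+\<^sub>1\<close> for each \<open>i < n\<close>, so it can be
  weakened to the conjunction of these, whose conjuncts can then be removed one at a time. The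
  left-hand side \<open>A \<sqinter> \<exists>r.\<top>\<close> does not hold below the root of the countermodels, so that the GCI
  has no effect there.\<close>

section \<open>Subsumption\<close>

text \<open>Transfers entailment to interpretations over any domain type; the countermodels below
  have domain type \<open>node\<close>.\<close>

lemma entailsD:
  fixes I :: "('c, 'r, 'd) interp"
  assumes "entails ont \<alpha>" "is_model I ont"
  shows "satisfies I \<alpha>"
  using assms entails_iff_any_domain[where 'd = 'd, of ont \<alpha>] by blast

lemma tautologyD:
  fixes I :: "('c, 'r, 'd) interp"
  assumes "tautology (GCI C D)" "is_interp I"
  shows "ext I C \<subseteq> ext I D"
  using entailsD[of "{}" "GCI C D" I] assms by (simp add: tautology_def is_model_def satisfies_def)

lemma tautologyI:
  assumes "\<And>I :: ('c, 'r, ('c, 'r) concept) interp. is_interp I \<Longrightarrow> ext I C \<subseteq> ext I D"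
  shows "tautology (GCI C D)"
  using assms by (simp add: tautology_def entails_def is_model_def satisfies_def)

lemma tautology_refl: "tautology (GCI C C)"
  by (simp add: tautologyI)

lemma tautology_trans: "tautology (GCI C D) \<Longrightarrow> tautology (GCI D E) \<Longrightarrow> tautology (GCI C E)"
  by (meson tautologyI tautologyD order_trans)

lemma entails_self: "\<beta> \<in> ont \<Longrightarrow> entails ont \<beta>"
  by (simp add: entails_def is_model_def)

lemma entails_cut: "entails ont \<beta> \<Longrightarrow> entails {\<beta>} \<alpha> \<Longrightarrow> entails ont \<alpha>"
  by (simp add: entails_def is_model_def)

lemma entails_weaken_rhs: "entails ont (GCI C D) \<Longrightarrow> tautology (GCI D D') \<Longrightarrow> entails ont (GCI C D')"
  by (auto simp: entails_def is_model_def satisfies_def dest: tautologyD)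

lemma tautology_Top: "tautology (GCI C Top)"
  by (simp add: tautologyI ext_subset_dom)

lemma succ_sub_iff [simp]:
  "(GCI C D, GCI C' D') \<in> succ_sub \<longleftrightarrow>
     C' = C \<and> tautology (GCI D D') \<and> \<not> entails {GCI C D'} (GCI C D)"
  by (auto simp: succ_sub_def)

lemma succ_subE:
  assumes "(\<beta>, \<gamma>) \<in> succ_sub"
  obtains C D D' where "\<beta> = GCI C D" "\<gamma> = GCI C D'" "tautology (GCI D D')"
    "\<not> entails {GCI C D'} (GCI C D)"
  using assms by (auto simp: succ_sub_def)

section \<open>Weakening relation and completeness\<close>

lemma weakening_relation_succ_sub: "weakening_relation succ_sub"
proof -
  have "irrefl succ_sub"
    by (auto simp: irrefl_def elim!: succ_subE intro: entails_self)
  moreover have "trans succ_sub"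
    by (intro transI)
      (auto elim!: succ_subE intro: tautology_trans dest: entails_weaken_rhs)
  moreover have "Con {\<gamma>} \<subset> Con {\<beta>}" if "(\<beta>, \<gamma>) \<in> succ_sub" for \<beta> \<gamma> :: "('c, 'r) gci"
    using that
  proof (rule succ_subE)
    fix C D D'
    assume *: "\<beta> = GCI C D" "\<gamma> = GCI C D'" "tautology (GCI D D')"
      "\<not> entails {GCI C D'} (GCI C D)"
    then have "entails {\<beta>} \<gamma>"
      by (metis entails_self entails_weaken_rhs singletonI)
    then have "Con {\<gamma>} \<subseteq> Con {\<beta>}"
      by (auto simp: Con_def intro: entails_cut)
    moreover have "\<beta> \<in> Con {\<beta>}" "\<beta> \<notin> Con {\<gamma>}"
      using * by (auto simp: Con_def intro: entails_self)
    ultimately show ?thesis by blast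
  qed
  ultimately show ?thesis
    by (auto simp: weakening_relation_def)
qed

lemma complete_succ_sub: "complete_rel succ_sub"
  unfolding complete_rel_def
proof (intro allI impI)
  fix \<beta> :: "('c, 'r) gci"
  assume nt: "\<not> tautology \<beta>"
  obtain C D where \<beta>: "\<beta> = GCI C D" by (cases \<beta>)
  \<comment> \<open>\<open>GCI C Top\<close> is a tautology, so whatever it entails is a tautology
    too.\<close>
  have "\<not> entails {GCI C Top} (GCI C D)"
    using nt \<beta> entails_cut[of "{}" "GCI C Top"] tautology_Top[of C] by (auto simp: tautology_def)
  then show "\<exists>\<gamma>. tautology \<gamma> \<and> (\<beta>, \<gamma>) \<in> succ_sub"
    using \<beta> by (intro exI[of _ "GCI C Top"]) (simp add: tautology_Top)
qed

section \<open>Finiteness of the set of subsumers\<close>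

primrec conjuncts :: "('c, 'r) concept \<Rightarrow> ('c, 'r) concept set" where
  "conjuncts Top = {}"
| "conjuncts (Name A) = {Name A}"
| "conjuncts (Conj C D) = conjuncts C \<union> conjuncts D"
| "conjuncts (Ex r C) = {Ex r C}"

text \<open>The disjoint union of the description trees of all concepts; the node \<open>C\<close> is the root of the
  tree of \<open>C\<close>.\<close>

definition tree_interp :: "('c, 'r, ('c, 'r) concept) interp" where
  "tree_interp = \<lparr>dom = UNIV,
     name_int = (\<lambda>A. {C. Name A \<in> conjuncts C}),
     role_int = (\<lambda>r. {(C, D). Ex r D \<in> conjuncts C})\<rparr>"

lemma tree_interp_simps [simp]:
  "dom tree_interp = UNIV"
  "C \<in> name_int tree_interp A \<longleftrightarrow> Name A \<in> conjuncts C"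
  "(C, D) \<in> role_int tree_interp r \<longleftrightarrow> Ex r D \<in> conjuncts C"
  by (auto simp: tree_interp_def)

lemma is_interp_tree_interp: "is_interp tree_interp"
  by (simp add: is_interp_def tree_interp_def)

text \<open>Used for \<open>C = D\<close>; the inclusion is what survives the descent into a
  conjunction. In the \<open>Ex\<close> case, \<open>D\<close> itself serves as the
  successor.\<close>

lemma ext_tree_interp_if_conjuncts: "conjuncts D \<subseteq> conjuncts C \<Longrightarrow> C \<in> ext tree_interp D"
proof (induction D arbitrary: C)
  case (Ex r D)
  then show ?case by auto
qed auto

lemma ext_conjunct: "is_interp I \<Longrightarrow> E \<in> conjuncts C \<Longrightarrow> ext I C \<subseteq> ext I E"
  by (induction C) auto

lemma tautology_if_ext_tree_interp: "C \<in> ext tree_interp D \<Longrightarrow> tautology (GCI C D)"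
proof (induction D arbitrary: C)
  case Top
  then show ?case by (simp add: tautology_Top)
next
  case (Name A)
  then show ?case using ext_conjunct[of _ "Name A" C] by (intro tautologyI) simp
next
  case (Conj D1 D2)
  then have "tautology (GCI C D1)" "tautology (GCI C D2)" by simp_all
  then show ?case by (intro tautologyI) (simp add: tautologyD)
next
  case (Ex r D)
  then obtain F where F: "Ex r F \<in> conjuncts C" "tautology (GCI F D)" by auto
  show ?case
  proof (rule tautologyI)
    fix I :: "('a, 'b, ('a, 'b) concept) interp"
    assume I: "is_interp I"
    show "ext I C \<subseteq> ext I (Ex r D)"
      using ext_conjunct[OF I F(1)] tautologyD[OF F(2) I] by auto
  qed
qed

text \<open>The tree of \<open>C\<close> is a universal model: its root satisfies \<open>C\<close>,
  and nothing beyond the subsumers of \<open>C\<close>. These can thus be analysed by induction on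
  their own structure.\<close>

lemma tautology_iff: "tautology (GCI C D) \<longleftrightarrow> C \<in> ext tree_interp D"
  using tautologyD[OF _ is_interp_tree_interp] ext_tree_interp_if_conjuncts[of C C]
    tautology_if_ext_tree_interp by blast

text \<open>Represents a concept up to equivalence. The value \<open>{}\<close> on records that are
  no interpretations makes the pointwise order coincide with subsumption.\<close>

definition sem :: "('c, 'r) concept \<Rightarrow> ('c, 'r, ('c, 'r) concept) interp \<Rightarrow> ('c, 'r) concept set" where
  "sem C I = (if is_interp I then ext I C else {})"

lemma tautology_sem: "tautology (GCI C D) \<longleftrightarrow> sem C \<le> sem D"
  by (auto simp: sem_def le_fun_def intro: tautologyI dest: tautologyD)

lemma sem_Conj: "sem (Conj C D) = (\<lambda>I. sem C I \<inter> sem D I)"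
  by (rule HOL.ext) (simp add: sem_def)

lemma sem_Conj_Top: "sem (Conj C Top) = sem C" "sem (Conj Top C) = sem C"
  using ext_subset_dom[of _ C] by (auto simp: sem_def fun_eq_iff)

text \<open>For a finite set \<open>S\<close> of values of \<open>sem\<close>, the meaning of the
  conjunction of all \<open>Ex r E\<close> with \<open>sem E\<close> in \<open>S\<close>;
  intersecting with \<open>dom I\<close> yields the meaning of \<open>Top\<close> for empty
  \<open>S\<close>.\<close>

definition sem_Exs ::
  "'r \<Rightarrow> (('c, 'r, ('c, 'r) concept) interp \<Rightarrow> ('c, 'r) concept set) set \<Rightarrow>
     ('c, 'r, ('c, 'r) concept) interp \<Rightarrow> ('c, 'r) concept set" where
  "sem_Exs r S I =
     (if is_interp I then dom I \<inter> (\<Inter>f\<in>S. {d. \<exists>e\<in>f I. (d, e) \<in> role_int I r}) else {})"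

text \<open>Up to equivalence, \<open>Top\<close> has only itself as a subsumer, and
  \<open>Name A\<close> only itself and \<open>Top\<close>. Subsumers of a conjunction are
  conjunctions of subsumers of its two parts. Those of \<open>Ex r D\<close> are conjunctions of
  concepts \<open>Ex r E\<close> with \<open>E\<close> subsuming \<open>D\<close>, hence determined
  by a subset of a finite set.\<close>

lemma finite_subsumers: "finite (sem ` {D'. tautology (GCI D D')})"
proof (induction D)
  case Top
  have "sem D' = sem Top" if "Top \<in> ext tree_interp D'" for D' :: "('a, 'b) concept"
    using that by (induction D') (auto simp: sem_Conj)
  then have "sem ` {D'. tautology (GCI Top D')} \<subseteq> {sem Top :: ('a, 'b, ('a, 'b) concept) interp \<Rightarrow> _}"
    unfolding tautology_iff by blast
  then show ?case by (rule finite_subset) simp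
next
  case (Name A)
  have "sem D' \<in> {sem Top, sem (Name A)}" if "Name A \<in> ext tree_interp D'" for D' :: "('a, 'b) concept"
    using that
  proof (induction D')
    case (Conj D1 D2)
    then have "sem D1 \<in> {sem Top, sem (Name A)}" "sem D2 \<in> {sem Top, sem (Name A)}" by auto
    then show ?case
      using sem_Conj_Top[of "Name A :: ('a, 'b) concept"] by (auto simp: sem_Conj)
  qed auto
  then have "sem ` {D'. tautology (GCI (Name A) D')} \<subseteq>
      {sem Top, sem (Name A) :: ('a, 'b, ('a, 'b) concept) interp \<Rightarrow> _}"
    unfolding tautology_iff by blast
  then show ?case by (rule finite_subset) simp
next
  case (Conj D1 D2)
  let ?S = "\<lambda>D :: ('a, 'b) concept. sem ` {D'. tautology (GCI D D')}"
  have "\<exists>E1 E2. D1 \<in> ext tree_interp E1 \<and> D2 \<in> ext tree_interp E2 \<and> sem D' = sem (Conj E1 E2)"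
    if "Conj D1 D2 \<in> ext tree_interp D'" for D'
    using that
  proof (induction D')
    case Top
    show ?case by (rule exI[of _ Top], rule exI[of _ Top]) (simp add: sem_Conj)
  next
    case (Name A)
    then consider "D1 \<in> ext tree_interp (Name A)" | "D2 \<in> ext tree_interp (Name A)" by auto
    then show ?case
    proof cases
      case 1
      then show ?thesis by (intro exI[of _ "Name A"] exI[of _ Top]) (simp add: sem_Conj_Top)
    next
      case 2
      then show ?thesis by (intro exI[of _ Top] exI[of _ "Name A"]) (simp add: sem_Conj_Top)
    qed
  next
    case (Conj F G)
    then obtain E1 E2 E1' E2' where
      "D1 \<in> ext tree_interp E1" "D2 \<in> ext tree_interp E2" "sem F = sem (Conj E1 E2)"
      "D1 \<in> ext tree_interp E1'" "D2 \<in> ext tree_interp E2'" "sem G = sem (Conj E1' E2')"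
      by auto
    \<comment> \<open>Regrouping the four conjuncts separates the subsumers of \<open>D1\<close>
      from those of \<open>D2\<close>.\<close>
    then show ?case
      by (intro exI[of _ "Conj E1 E1'"] exI[of _ "Conj E2 E2'"]) (auto simp: sem_Conj)
  next
    case (Ex r E)
    then consider "D1 \<in> ext tree_interp (Ex r E)" | "D2 \<in> ext tree_interp (Ex r E)" by auto
    then show ?case
    proof cases
      case 1
      then show ?thesis by (intro exI[of _ "Ex r E"] exI[of _ Top]) (simp add: sem_Conj_Top)
    next
      case 2
      then show ?thesis by (intro exI[of _ Top] exI[of _ "Ex r E"]) (simp add: sem_Conj_Top)
    qed
  qed
  then have decompose:
    "\<exists>E1 E2. tautology (GCI D1 E1) \<and> tautology (GCI D2 E2) \<and> sem D' = sem (Conj E1 E2)"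
    if "tautology (GCI (Conj D1 D2) D')" for D'
    using that unfolding tautology_iff .
  have "?S (Conj D1 D2) \<subseteq> (\<lambda>(f, g) I. f I \<inter> g I) ` (?S D1 \<times> ?S D2)"
  proof
    fix f
    assume "f \<in> ?S (Conj D1 D2)"
    then obtain D' where "f = sem D'" "tautology (GCI (Conj D1 D2) D')" by blast
    with decompose obtain E1 E2 where
      "tautology (GCI D1 E1)" "tautology (GCI D2 E2)" "f = sem (Conj E1 E2)" by metis
    then show "f \<in> (\<lambda>(f, g) I. f I \<inter> g I) ` (?S D1 \<times> ?S D2)"
      by (intro image_eqI[of _ _ "(sem E1, sem E2)"]) (simp_all add: sem_Conj)
  qed
  then show ?case
    by (rule finite_subset) (intro finite_imageI finite_cartesian_product Conj)
next
  case (Ex r D)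
  let ?S = "sem ` {D'. tautology (GCI D D')}"
  have "sem D' \<in> sem_Exs r ` Pow ?S" if "Ex r D \<in> ext tree_interp D'" for D'
    using that
  proof (induction D')
    case Top
    have "sem Top = sem_Exs r {}" by (rule HOL.ext) (simp add: sem_def sem_Exs_def)
    then show ?case by (rule image_eqI) simp
  next
    case (Conj F G)
    then have "sem F \<in> sem_Exs r ` Pow ?S" "sem G \<in> sem_Exs r ` Pow ?S" by simp_all
    then obtain T T' where T: "T \<in> Pow ?S" "T' \<in> Pow ?S"
      and sem_eq: "sem F = sem_Exs r T" "sem G = sem_Exs r T'" by (elim imageE)
    \<comment> \<open>Conjunction becomes union of the index sets.\<close>
    have "sem (Conj F G) = sem_Exs r (T \<union> T')"
      unfolding sem_Conj sem_eq by (rule HOL.ext) (auto simp: sem_Exs_def)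
    then show ?case by (rule image_eqI) (use T in simp)
  next
    case (Ex s E)
    then have *: "s = r" "D \<in> ext tree_interp E" by auto
    have "sem (Ex r E) = sem_Exs r {sem E}"
      using ext_subset_dom[of _ "Ex r E"] by (intro HOL.ext) (auto simp: sem_def sem_Exs_def)
    then show ?case unfolding *(1) by (rule image_eqI) (use * in \<open>simp add: tautology_iff\<close>)
  qed simp
  then have "sem ` {D'. tautology (GCI (Ex r D) D')} \<subseteq> sem_Exs r ` Pow ?S"
    unfolding tautology_iff by blast
  then show ?case
    by (rule finite_subset) (simp add: Ex)
qed

section \<open>The number of subsumers as a measure\<close>

definition num_subsumers :: "('c, 'r) gci \<Rightarrow> nat" where
  "num_subsumers \<beta> = card (sem ` {D'. tautology (GCI (rhs \<beta>) D')})"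

text \<open>By transitivity, every subsumer of the weaker right-hand side subsumes the stronger one.
  The stronger one itself is lost: otherwise both would be equivalent and the weaker GCI would
  entail the stronger.\<close>

lemma num_subsumers_less:
  assumes "(\<beta>, \<gamma>) \<in> succ_sub"
  shows "num_subsumers \<gamma> < num_subsumers \<beta>"
  using assms
proof (rule succ_subE)
  fix C D D'
  assume *: "\<beta> = GCI C D" "\<gamma> = GCI C D'" "tautology (GCI D D')"
    "\<not> entails {GCI C D'} (GCI C D)"
  have "sem D \<notin> sem ` {E. tautology (GCI D' E)}"
  proof
    assume "sem D \<in> sem ` {E. tautology (GCI D' E)}"
    then have "tautology (GCI D' D)" by (auto simp: tautology_sem)
    then show False using * by (metis entails_self entails_weaken_rhs singletonI)
  qed
  then have "sem ` {E. tautology (GCI D' E)} \<subset> sem ` {E. tautology (GCI D E)}"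
    using * tautology_refl[of D] by (blast intro: tautology_trans)
  then show ?thesis
    unfolding num_subsumers_def * by (simp add: psubset_card_mono finite_subsumers)
qed

lemma well_founded_rel_if_measure:
  fixes m :: "('c, 'r) gci \<Rightarrow> nat"
  assumes "\<And>\<beta> \<gamma>. (\<beta>, \<gamma>) \<in> R \<Longrightarrow> m \<gamma> < m \<beta>"
  shows "well_founded_rel R"
  using assms wf_measure[of m] unfolding well_founded_rel_def wf_iff_no_infinite_down_chain
  by (metis in_measure)

text \<open>Induction on the decrease of \<open>m\<close>: a pair that is not a single step splits
  at some \<open>\<delta>\<close>, and both halves have a smaller decrease.\<close>

lemma one_step_generated_if_measure:
  fixes m :: "('c, 'r) gci \<Rightarrow> nat"
  assumes less: "\<And>\<beta> \<gamma>. (\<beta>, \<gamma>) \<in> R \<Longrightarrow> m \<gamma> < m \<beta>" and "trans R"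
  shows "one_step_generated R"
proof -
  have "(\<beta>, \<gamma>) \<in> (one_step R)\<^sup>+" if "(\<beta>, \<gamma>) \<in> R" for \<beta> \<gamma>
    using that
  proof (induction "m \<beta> - m \<gamma>" arbitrary: \<beta> \<gamma> rule: less_induct)
    case less
    show ?case
    proof (cases "(\<beta>, \<gamma>) \<in> one_step R")
      case False
      with less.prems obtain \<delta> where \<delta>: "(\<beta>, \<delta>) \<in> R" "(\<delta>, \<gamma>) \<in> R"
        by (auto simp: one_step_def)
      then have "m \<gamma> < m \<delta>" "m \<delta> < m \<beta>" by (simp_all add: assms)
      then have "(\<beta>, \<delta>) \<in> (one_step R)\<^sup>+" "(\<delta>, \<gamma>) \<in> (one_step R)\<^sup>+"
        using \<delta> by (auto intro!: less.hyps)
      then show ?thesis by simp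
    qed simp
  qed
  moreover have "(one_step R)\<^sup>+ \<subseteq> R\<^sup>+"
    by (rule trancl_mono_subset) (auto simp: one_step_def)
  ultimately show ?thesis
    using trancl_id[OF \<open>trans R\<close>] by (auto simp: one_step_generated_def)
qed

section \<open>Exponentially long chains\<close>

definition big_conj :: "('c, 'r) concept list \<Rightarrow> ('c, 'r) concept" where
  "big_conj Cs = foldr Conj Cs Top"

lemma ext_big_conj: "ext I (big_conj Cs) = dom I \<inter> (\<Inter>C\<in>set Cs. ext I C)"
  by (induction Cs) (auto simp: big_conj_def)

lemma size_big_conj: "concept_size (big_conj Cs) = Suc (\<Sum>C\<leftarrow>Cs. concept_size C)"
  by (induction Cs) (auto simp: big_conj_def)

definition marker :: "'c \<Rightarrow> 'r \<Rightarrow> nat \<Rightarrow> ('c, 'r) concept" where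
  "marker A r i = (Ex r ^^ Suc i) (Name A)"

text \<open>Bit \<open>i\<close> of \<open>j\<close> selects one marker of the \<open>i\<close>-th
  pair, so the numbers below \<open>2 ^ n\<close> enumerate all selections.\<close>

definition choice_idx :: "nat \<Rightarrow> nat \<Rightarrow> nat" where
  "choice_idx j i = 2 * i + of_bool (bit j i)"

definition choice :: "'c \<Rightarrow> 'r \<Rightarrow> nat \<Rightarrow> nat \<Rightarrow> ('c, 'r) concept" where
  "choice A r n j = big_conj (map (\<lambda>i. marker A r (choice_idx j i)) [0..<n])"

definition choices :: "'c \<Rightarrow> 'r \<Rightarrow> nat \<Rightarrow> nat \<Rightarrow> ('c, 'r) concept" where
  "choices A r n k = big_conj (map (\<lambda>j. Ex r (choice A r n j)) [0..<k])"

definition all_markers :: "'c \<Rightarrow> 'r \<Rightarrow> nat \<Rightarrow> ('c, 'r) concept" where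
  "all_markers A r n = Ex r (big_conj (map (marker A r) [0..<2 * n]))"

definition guard :: "'c \<Rightarrow> 'r \<Rightarrow> ('c, 'r) concept" where
  "guard A r = Conj (Name A) (Ex r Top)"

lemma choice_idx_less: "i < n \<Longrightarrow> choice_idx j i < 2 * n"
  by (auto simp: choice_idx_def)

lemma choice_idx_eq_iff: "choice_idx j i = choice_idx j' i' \<longleftrightarrow> i = i' \<and> (bit j i \<longleftrightarrow> bit j' i)"
  unfolding choice_idx_def by (cases "bit j i"; cases "bit j' i'"; auto; presburger)

lemma eq_if_bits_eq:
  fixes j k :: nat
  assumes "j < 2 ^ n" "k < 2 ^ n" "\<And>i. i < n \<Longrightarrow> bit j i \<longleftrightarrow> bit k i"
  shows "j = k"
proof -
  have "take_bit n j = take_bit n k"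
    using assms(3) by (auto intro!: bit_eqI simp: bit_take_bit_iff)
  with assms show ?thesis by (simp add: take_bit_nat_eq_self)
qed

lemma concept_size_marker: "concept_size (marker A r i) = i + 2"
  unfolding marker_def by (induction i) auto

lemma size_all_markers: "gci_size (GCI (guard A r) (all_markers A r n)) = 2 * n\<^sup>2 + 3 * n + 5"
proof -
  have "(\<Sum>i\<leftarrow>[0..<2 * n]. i + 2) = 2 * n\<^sup>2 + 3 * n"
    by (induction n) (auto simp: power2_eq_square)
  then show ?thesis
    by (simp add: gci_size_def guard_def all_markers_def size_big_conj concept_size_marker o_def)
qed

lemma tautology_all_markers_choices: "tautology (GCI (all_markers A r n) (choices A r n k))"
proof (rule tautologyI)
  fix I :: "('a, 'b, ('a, 'b) concept) interp"
  assume I: "is_interp I"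
  have "ext I (big_conj (map (marker A r) [0..<2 * n])) \<subseteq> ext I (choice A r n j)" for j
    by (auto simp: choice_def ext_big_conj choice_idx_less)
  then show "ext I (all_markers A r n) \<subseteq> ext I (choices A r n k)"
    using I by (auto simp: all_markers_def choices_def ext_big_conj is_interp_def)
qed

lemma tautology_choices_Suc: "tautology (GCI (choices A r n (Suc k)) (choices A r n k))"
  by (rule tautologyI) (auto simp: choices_def ext_big_conj)

section \<open>The countermodels\<close>

datatype node = Root | Choice nat | Chain nat

text \<open>\<open>Chain m\<close> starts a path of length \<open>m\<close> ending in \<open>A\<close>. The edge from \<open>Root\<close> to \<open>Chain 0\<close> makes
  the left-hand side hold at \<open>Root\<close> even for \<open>k = 0\<close>.\<close>

definition countermodel :: "nat \<Rightarrow> nat \<Rightarrow> ('c, 'r, node) interp" where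
  "countermodel n k = \<lparr>dom = UNIV,
     name_int = (\<lambda>_. {Root, Chain 0}),
     role_int = (\<lambda>_. {(Root, Chain 0)} \<union> {(Root, Choice j) | j. j < k} \<union>
       {(Choice j, Chain (choice_idx j i)) | i j. i < n} \<union> {(Chain (Suc m), Chain m) | m. True})\<rparr>"

lemma is_interp_countermodel: "is_interp (countermodel n k)"
  by (simp add: is_interp_def countermodel_def)

lemma countermodel_role_iff:
  "(Root, y) \<in> role_int (countermodel n k) r \<longleftrightarrow> y = Chain 0 \<or> (\<exists>j<k. y = Choice j)"
  "(Choice j, y) \<in> role_int (countermodel n k) r \<longleftrightarrow> (\<exists>i<n. y = Chain (choice_idx j i))"
  "(Chain m, y) \<in> role_int (countermodel n k) r \<longleftrightarrow> (\<exists>l. m = Suc l \<and> y = Chain l)"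
  by (auto simp: countermodel_def)

lemma countermodel_name: "name_int (countermodel n k) A = {Root, Chain 0}"
  by (simp add: countermodel_def)

lemma countermodel_dom: "dom (countermodel n k) = UNIV"
  by (simp add: countermodel_def)

text \<open>Each path node has at most one successor and only the last one carries \<open>A\<close>,
  so nesting depth and path length must agree.\<close>

lemma Chain_in_ext: "Chain m \<in> ext (countermodel n k) ((Ex r ^^ i) (Name A)) \<longleftrightarrow> m = i"
  by (induction i arbitrary: m) (auto simp: countermodel_role_iff countermodel_name)

lemma Choice_in_ext_marker:
  "Choice j \<in> ext (countermodel n k) (marker A r m) \<longleftrightarrow> (\<exists>i<n. m = choice_idx j i)"
  by (auto simp: marker_def countermodel_role_iff Chain_in_ext)

text \<open>\<open>Choice j\<close> satisfies exactly one marker of each of the \<open>n\<close>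
  pairs. Satisfying the choice \<open>l\<close> therefore forces the bits of \<open>j\<close> and
  \<open>l\<close> below \<open>n\<close> to agree.\<close>

lemma Choice_in_ext_choice:
  assumes "j < 2 ^ n" "l < 2 ^ n"
  shows "Choice j \<in> ext (countermodel n k) (choice A r n l) \<longleftrightarrow> j = l"
  using assms eq_if_bits_eq[of j n l]
  by (auto simp: choice_def ext_big_conj countermodel_dom Choice_in_ext_marker choice_idx_eq_iff)

text \<open>\<open>Chain 0\<close> is a successor of \<open>Root\<close>, so it must be ruled out as
  a witness for \<open>Ex r (choice A r n l)\<close>. Every marker demands a successor, which
  \<open>Chain 0\<close> lacks, and \<open>0 < n\<close> puts a marker into the choice.\<close>

lemma Chain_0_notin_ext_choice:
  assumes "0 < n"
  shows "Chain 0 \<notin> ext (countermodel n k) (choice A r n l)"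
proof
  assume "Chain 0 \<in> ext (countermodel n k) (choice A r n l)"
  then have "Chain 0 \<in> ext (countermodel n k) (marker A r (choice_idx l 0))"
    using assms by (auto simp: choice_def ext_big_conj)
  then show False
    unfolding marker_def Chain_in_ext by simp
qed

lemma Root_in_ext_choices:
  assumes "0 < n" "k \<le> 2 ^ n" "l \<le> 2 ^ n"
  shows "Root \<in> ext (countermodel n k) (choices A r n l) \<longleftrightarrow> l \<le> k"
proof -
  \<comment> \<open>As all indices are below \<open>2 ^ n\<close>, the only possible witness is
    \<open>Choice j\<close>, a successor of \<open>Root\<close> exactly if
    \<open>j < k\<close>.\<close>
  have "Root \<in> ext (countermodel n k) (Ex r (choice A r n j)) \<longleftrightarrow> j < k" if "j < l" for j
    using assms that
    by (auto simp: countermodel_role_iff Choice_in_ext_choice Chain_0_notin_ext_choice)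
  then have "Root \<in> ext (countermodel n k) (choices A r n l) \<longleftrightarrow> (\<forall>j<l. j < k)"
    by (auto simp: choices_def ext_big_conj countermodel_dom)
  also have "\<dots> \<longleftrightarrow> l \<le> k" by (meson leI le_less_trans less_le_trans order_less_irrefl)
  finally show ?thesis .
qed

text \<open>\<open>Chain 0\<close> carries \<open>A\<close> as well, but it has no
  successor.\<close>

lemma ext_guard_countermodel: "ext (countermodel n k) (guard A r) = {Root}"
proof -
  have "x \<in> ext (countermodel n k) (guard A r) \<longleftrightarrow> x = Root" for x
    by (cases x) (auto simp: guard_def countermodel_role_iff countermodel_name countermodel_dom)
  then show ?thesis by blast
qed

text \<open>In \<open>countermodel n k\<close> the guard holds at \<open>Root\<close> only, where
  the choices below \<open>k\<close> have witnesses but choice \<open>k\<close> has none.\<close>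

lemma not_entails_choices_Suc:
  assumes "0 < n" "k < 2 ^ n"
  shows "\<not> entails {GCI (guard A r) (choices A r n k)} (GCI (guard A r) (choices A r n (Suc k)))"
proof
  assume *: "entails {GCI (guard A r) (choices A r n k)} (GCI (guard A r) (choices A r n (Suc k)))"
  have "is_model (countermodel n k) {GCI (guard A r) (choices A r n k)}"
    using assms
    by (simp add: is_model_def is_interp_countermodel satisfies_def ext_guard_countermodel
        Root_in_ext_choices)
  from entailsD[OF * this] show False
    using assms by (simp add: satisfies_def ext_guard_countermodel Root_in_ext_choices)
qed

section \<open>Length of the chains against the size of the GCI\<close>

lemma choices_chain:
  assumes "0 < n" "k \<le> 2 ^ n"
  shows "(GCI (guard A r) (choices A r n k), GCI (guard A r) (choices A r n 0)) \<in> succ_sub ^^ k"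
  using assms(2)
proof (induction k)
  case (Suc k)
  then have "(GCI (guard A r) (choices A r n (Suc k)), GCI (guard A r) (choices A r n k)) \<in> succ_sub"
    using assms(1) by (simp add: tautology_choices_Suc not_entails_choices_Suc)
  with Suc show ?case by (meson Suc_leD relpow_Suc_I2)
qed simp

lemma all_markers_chain:
  assumes "0 < n"
  shows "(GCI (guard A r) (all_markers A r n), GCI (guard A r) (choices A r n 0)) \<in> succ_sub ^^ 2 ^ n"
proof -
  obtain k where k: "2 ^ n = Suc k"
    by (metis not0_implies_Suc power_not_zero zero_neq_numeral)
  \<comment> \<open>The first step goes straight to \<open>k = 2 ^ n - 1\<close> choices, which
    together with the \<open>k\<close> removals makes \<open>2 ^ n\<close> steps. It is strict
    because \<open>all_markers\<close> still implies the choice left out.\<close>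
  have "\<not> entails {GCI (guard A r) (choices A r n k)} (GCI (guard A r) (all_markers A r n))"
    using not_entails_choices_Suc[OF assms, of k A r] k tautology_all_markers_choices
    by (metis entails_weaken_rhs lessI)
  then have "(GCI (guard A r) (all_markers A r n), GCI (guard A r) (choices A r n k)) \<in> succ_sub"
    by (simp add: tautology_all_markers_choices)
  with choices_chain[OF assms, of k A r] show ?thesis
    unfolding k by (meson k less_imp_le lessI relpow_Suc_I2 order_refl le_SucI)
qed

text \<open>Termwise: a polynomial is a finite sum of monomials, each negligible against
  \<open>2 ^ n\<close>.\<close>

lemma poly_over_two_power_tendsto_0:
  fixes p :: "real poly"
  shows "(\<lambda>n. poly p (real n) / 2 ^ n) \<longlonglongrightarrow> 0"
proof -
  have "(\<lambda>n. coeff p i * (real n ^ i / 2 ^ n)) \<longlonglongrightarrow> 0" for i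
  proof -
    have "(\<lambda>n. real n ^ i / 2 ^ n) \<longlonglongrightarrow> 0" by real_asymp
    then show ?thesis by (rule tendsto_mult_right_zero)
  qed
  then have "(\<lambda>n. \<Sum>i\<le>degree p. coeff p i * (real n ^ i / 2 ^ n)) \<longlonglongrightarrow> 0"
    by (intro tendsto_null_sum)
  then show ?thesis
    by (simp add: poly_altdef sum_divide_distrib)
qed

lemma not_polynomial_succ_sub: "\<not> polynomial_rel (succ_sub :: ('c, 'r) gci rel)"
proof
  assume "polynomial_rel (succ_sub :: ('c, 'r) gci rel)"
  then obtain p :: "real poly" where
    p: "(\<beta>, \<gamma>) \<in> succ_sub ^^ n \<Longrightarrow> real n \<le> poly p (real (gci_size \<beta>))"
    for \<beta> \<gamma> :: "('c, 'r) gci" and n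
    unfolding polynomial_rel_def by blast
  \<comment> \<open>\<open>[:5, 3, 2:]\<close> is the size of the starting GCI as a polynomial in
    \<open>n\<close>, by \<open>size_all_markers\<close>; so \<open>q\<close> bounds the chain
    length in terms of \<open>n\<close>.\<close>
  define q where "q = pcompose p [:5, 3, 2:]"
  have bound: "2 ^ n \<le> poly q (real n)" if "0 < n" for n
    using p[OF all_markers_chain[OF that]]
    by (simp add: size_all_markers q_def poly_pcompose algebra_simps power2_eq_square)
  have "\<forall>\<^sub>F n in sequentially. poly q (real n) / 2 ^ n < 1"
    by (rule order_tendstoD(2)[OF poly_over_two_power_tendsto_0]) simp
  then have "\<forall>\<^sub>F n in sequentially. 0 < n \<and> poly q (real n) / 2 ^ n < 1"
    using eventually_gt_at_top[of 0] by eventually_elim simp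
  then obtain n where "0 < n" "poly q (real n) / 2 ^ n < 1"
    using eventually_happens' sequentially_bot by blast
  with bound[of n] show False by (simp add: divide_simps)
qed

theorem theorem19:
  shows "weakening_relation (succ_sub :: ('c, 'r) gci rel)
    \<and> well_founded_rel (succ_sub :: ('c, 'r) gci rel)
    \<and> complete_rel (succ_sub :: ('c, 'r) gci rel)
    \<and> one_step_generated (succ_sub :: ('c, 'r) gci rel)
    \<and> \<not> polynomial_rel (succ_sub :: ('c, 'r) gci rel)"
proof (intro conjI)
  show "weakening_relation (succ_sub :: ('c, 'r) gci rel)"
    by (rule weakening_relation_succ_sub)
  then have "trans (succ_sub :: ('c, 'r) gci rel)"
    by (simp add: weakening_relation_def)
  with num_subsumers_less show "one_step_generated (succ_sub :: ('c, 'r) gci rel)"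
    by (rule one_step_generated_if_measure)
  show "well_founded_rel (succ_sub :: ('c, 'r) gci rel)"
    using num_subsumers_less by (rule well_founded_rel_if_measure)
qed (rule complete_succ_sub not_polynomial_succ_sub)+

end
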